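(* Let $N=2,4,8,16$ and let $\mathbb{K}=\mathbb{R},\mathbb{C},\mathbb{H},\mathbb{O}$ respectively, so that $\mathbb{R}^N=\mathbb{K}\times\mathbb{K}$ and $\mathbb{R}^{\dim\mathbb{K}+1}=\mathbb{K}\times\mathbb{R}$. Let $\pi:\mathbb{R}^N\to\mathbb{R}^{\dim\mathbb{K}+1}$, $\pi(z_1,z_2):=(2\overline{z_1}z_2,\,|z_1|^2-|z_2|^2)$, be the Hopf map. Let $U$ be a bounded smooth domain in $\mathbb{R}^{\dim\mathbb{K}+1}$ which does not contain the origin, $a\in\mathbb{R}$, and $f:\mathbb{R}\to\mathbb{R}$. If $v$ solves $$-\Delta v+\frac{a}{2|x|}v=\frac{1}{2|x|}f(v)\ \text{ in }U,\qquad v=0\ \text{ on }\partial U, \qquad (1)$$ then $u:=v\circ\pi$ is a solution of $$-\Delta u+au=f(u)\ \text{ in }\Omega:=\pi^{-1}(U),\qquad u=0\ \text{ on }\partial\Omega. \qquad (2)$$ Conversely, if $u$ is an $\mathbb{S}_{\mathbb{K}}$-invariant solution of $(2)$ and $u=v\circ\pi$, then $v$ solves $(1)$.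
   Context: $\mathbb{R},\mathbb{C},\mathbb{H},\mathbb{O}$ are the real numbers, complex numbers, quaternions and Cayley numbers (octonions), with real dimension $\dim\mathbb{K}=1,2,4,8$ and the usual conjugation and norm. $\mathbb{S}_{\mathbb{K}}:=\{\zeta\in\mathbb{K}:|\zeta|=1\}$ is the set of units of $\mathbb{K}$; it acts on $\mathbb{R}^N=\mathbb{K}\times\mathbb{K}$ by multiplication on each coordinate, $\zeta(z_1,z_2):=(\zeta z_1,\zeta z_2)$. The orbit space of this action is identified with $\mathbb{R}^{\dim\mathbb{K}+1}$, and the projection onto the orbit space with the Hopf map $\pi$. A function is $\mathbb{S}_{\mathbb{K}}$-invariant if it is constant on the orbits of this action. $\Delta$ is the usual Laplacian (sum of second derivatives), on $\mathbb{R}^{\dim\mathbb{K}+1}$ in (1) and on $\mathbb{R}^N$ in (2). The functions $u$ and $v$ are real-valued.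
   Formalization: In (1) the factors a/(2|x|) and 1/(2|x|) are corrected to a/(4|x|) and 1/(4|x|), since Δ(v∘π)=4|x|Δv at x=π(z) for this π; with the printed factors the claim fails (N=2, a=0, f=1, U={1<|x|<2}). Solutions are classical: C² inside, continuous up to the boundary. *)

theory Defs
  imports "HOL-Analysis.Analysis"
begin

section \<open>Quaternions and octonions\<close>

text \<open>
  The Cayley--Dickson doubling of an algebra with product \<open>m\<close> and conjugation \<open>c\<close>. It lives on a
  product type, so the library's Euclidean structure on pairs supplies the usual norm and the usual
  orthonormal basis. A quaternion \<open>(a, b)\<close> stands for \<open>a + b j\<close> with complex \<open>a\<close>, \<open>b\<close>.
\<close>

definition cd_mult ::
  "('k::ab_group_add \<Rightarrow> 'k \<Rightarrow> 'k) \<Rightarrow> ('k \<Rightarrow> 'k) \<Rightarrow> 'k \<times> 'k \<Rightarrow> 'k \<times> 'k \<Rightarrow> 'k \<times> 'k" where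
  "cd_mult m c p q =
     (m (fst p) (fst q) - m (c (snd q)) (snd p), m (snd q) (fst p) + m (snd p) (c (fst q)))"

definition cd_cnj :: "('k::ab_group_add \<Rightarrow> 'k) \<Rightarrow> 'k \<times> 'k \<Rightarrow> 'k \<times> 'k" where
  "cd_cnj c p = (c (fst p), - snd p)"

type_synonym quaternion = "complex \<times> complex"
type_synonym octonion = "quaternion \<times> quaternion"

definition quat_mult :: "quaternion \<Rightarrow> quaternion \<Rightarrow> quaternion" where
  "quat_mult = cd_mult (*) cnj"

definition quat_cnj :: "quaternion \<Rightarrow> quaternion" where
  "quat_cnj = cd_cnj cnj"

definition oct_mult :: "octonion \<Rightarrow> octonion \<Rightarrow> octonion" where
  "oct_mult = cd_mult quat_mult quat_cnj"

definition oct_cnj :: "octonion \<Rightarrow> octonion" where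
  "oct_cnj = cd_cnj quat_cnj"


section \<open>Hopf map and action of the units\<close>

text \<open>The arguments \<open>m\<close> and \<open>c\<close> are the product and the conjugation of the algebra \<open>'k\<close>.\<close>

definition hopf ::
  "('k::euclidean_space \<Rightarrow> 'k \<Rightarrow> 'k) \<Rightarrow> ('k \<Rightarrow> 'k) \<Rightarrow> 'k \<times> 'k \<Rightarrow> 'k \<times> real" where
  "hopf m c z = (2 *\<^sub>R m (c (fst z)) (snd z), (norm (fst z))\<^sup>2 - (norm (snd z))\<^sup>2)"

definition unit_orbit ::
  "('k::euclidean_space \<Rightarrow> 'k \<Rightarrow> 'k) \<Rightarrow> 'k \<times> 'k \<Rightarrow> ('k \<times> 'k) set" where
  "unit_orbit m z = {(m \<zeta> (fst z), m \<zeta> (snd z)) | \<zeta>. norm \<zeta> = 1}"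

text \<open>
  Invariance of a function given on \<open>D\<close>; only orbit points inside \<open>D\<close> are compared. For \<open>\<real>\<close>,
  \<open>\<complex>\<close> and the quaternions the preimages under the Hopf map are unions of orbits; for the
  octonions, where associativity fails, they need not be.
\<close>

definition unit_invariant_on ::
  "('k::euclidean_space \<Rightarrow> 'k \<Rightarrow> 'k) \<Rightarrow> ('k \<times> 'k) set \<Rightarrow> ('k \<times> 'k \<Rightarrow> real) \<Rightarrow> bool" where
  "unit_invariant_on m D u \<longleftrightarrow> (\<forall>z\<in>D. \<forall>w\<in>unit_orbit m z \<inter> D. u w = u z)"


section \<open>Differentiability classes, Laplacian, smooth domains\<close>

definition partial :: "'a::euclidean_space \<Rightarrow> ('a \<Rightarrow> real) \<Rightarrow> 'a \<Rightarrow> real" where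
  "partial b g x = frechet_derivative g (at x) b"

definition laplacian :: "('a::euclidean_space \<Rightarrow> real) \<Rightarrow> 'a \<Rightarrow> real" where
  "laplacian g x = (\<Sum>b\<in>Basis. partial b (partial b g) x)"

text \<open>The class \<open>C\<^sup>k(S)\<close>, meaningful for open \<open>S\<close>.\<close>

fun Ck_on :: "nat \<Rightarrow> ('a::euclidean_space \<Rightarrow> real) \<Rightarrow> 'a set \<Rightarrow> bool" where
  "Ck_on 0 g S \<longleftrightarrow> continuous_on S g"
| "Ck_on (Suc k) g S \<longleftrightarrow>
     (\<forall>x\<in>S. g differentiable (at x)) \<and> (\<forall>b\<in>Basis. Ck_on k (partial b g) S)"

text \<open>
  Smoothness of the boundary: near each boundary point \<open>p\<close>, the set is the sublevel set of a
  \<open>C\<^sup>\<infinity>\<close> function with nonvanishing gradient at \<open>p\<close>.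
\<close>

definition smooth_boundary :: "'a::euclidean_space set \<Rightarrow> bool" where
  "smooth_boundary U \<longleftrightarrow>
     (\<forall>p\<in>frontier U. \<exists>W \<rho>. open W \<and> p \<in> W \<and> (\<forall>k. Ck_on k \<rho> W) \<and>
        (\<exists>b\<in>Basis. partial b \<rho> p \<noteq> 0) \<and> \<rho> p = 0 \<and> U \<inter> W = {x\<in>W. \<rho> x < 0})"

definition bounded_smooth_domain :: "'a::euclidean_space set \<Rightarrow> bool" where
  "bounded_smooth_domain U \<longleftrightarrow>
     open U \<and> connected U \<and> U \<noteq> {} \<and> bounded U \<and> smooth_boundary U"


section \<open>The two Dirichlet problems\<close>

text \<open>
  Solutions are classical: of class \<open>C\<^sup>2\<close> inside and continuous up to the boundary. Only the values
  of the (total) functions on the closure matter.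

  The normalisation of \<open>hopf\<close> gives \<open>|\<pi>(z)| = |z|\<^sup>2\<close> and
  \<open>\<Delta>(v \<circ> \<pi>)(z) = 4 |z|\<^sup>2 (\<Delta>v)(\<pi>(z))\<close>. Hence the coefficient below is \<open>1/(4|x|)\<close>; the
  coefficient \<open>1/(2|x|)\<close> found in the literature belongs to the map \<open>\<pi>/2\<close>.
\<close>

definition solves_reduced ::
  "real \<Rightarrow> (real \<Rightarrow> real) \<Rightarrow> 'a::euclidean_space set \<Rightarrow> ('a \<Rightarrow> real) \<Rightarrow> bool" where
  "solves_reduced a f U v \<longleftrightarrow>
     Ck_on 2 v U \<and> continuous_on (closure U) v \<and>
     (\<forall>x\<in>U. - laplacian v x + a / (4 * norm x) * v x = 1 / (4 * norm x) * f (v x)) \<and>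
     (\<forall>x\<in>frontier U. v x = 0)"

definition solves_full ::
  "real \<Rightarrow> (real \<Rightarrow> real) \<Rightarrow> 'a::euclidean_space set \<Rightarrow> ('a \<Rightarrow> real) \<Rightarrow> bool" where
  "solves_full a f \<Omega> u \<longleftrightarrow>
     Ck_on 2 u \<Omega> \<and> continuous_on (closure \<Omega>) u \<and>
     (\<forall>z\<in>\<Omega>. - laplacian u z + a * u z = f (u z)) \<and>
     (\<forall>z\<in>frontier \<Omega>. u z = 0)"

end

theory Submission
  imports Defs
begin

text \<open>
  All four cases rest on one property of the algebra: the pairing
  \<open>B(x, y) = x\<^sup>* y\<close> is bilinear and satisfies \<open>|B(x, y)| = |x| |y|\<close>. Consequently
  left and right multiplications are multiples of orthogonal maps, and this makes the quadratic map
  \<open>\<pi>(z) = (2 B(z\<^sub>1, z\<^sub>2), |z\<^sub>1|\<^sup>2 - |z\<^sub>2|\<^sup>2)\<close> a harmonic morphism with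
  dilation \<open>2 |z|\<close>: its components are harmonic, and their gradients at \<open>z\<close> are orthogonal of
  length \<open>2 |z|\<close> (\<open>hopf_harmonic\<close>, \<open>dhopf_conformal\<close>). The chain rule then
  gives \<open>\<Delta>(v \<circ> \<pi>)(z) = 4 |z|\<^sup>2 (\<Delta>v)(\<pi>(z))\<close> (\<open>laplacian_comp_hopf\<close>). Since
  \<open>|\<pi>(z)| = |z|\<^sup>2\<close>, dividing the equation for \<open>v \<circ> \<pi>\<close> by \<open>4 |z|\<^sup>2\<close> is the
  equation for \<open>v\<close>.

  For the converse, the regularity of \<open>v\<close> has to be recovered from that of \<open>v \<circ> \<pi>\<close>. Away from the
  origin \<open>\<pi>\<close> has explicit differentiable local sections (\<open>hopf_local_section\<close>), so
  differentiability descends. Conformality expresses the partial derivatives of \<open>v\<close>, pulled back by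
  \<open>\<pi>\<close>, through those of \<open>v \<circ> \<pi>\<close>, and induction gives \<open>C\<^sup>k\<close> for every \<open>k\<close>
  (\<open>Ck_on_descend\<close>).

  Boundary values and continuity on the closures transfer because \<open>\<pi>\<close> is surjective and proper,
  hence a closed map: it sends the closure of \<open>\<pi>\<^sup>-\<^sup>1(U)\<close> onto that of \<open>U\<close>.

  It remains to see that the norms of \<open>\<real>\<close>, \<open>\<complex>\<close>, the quaternions and the octonions are
  multiplicative. For the last two this is one statement about the Cayley--Dickson doubling of an
  associative algebra (\<open>norm_cd_mult\<close>).
\<close>

section \<open>The calculus of the classes \<open>C\<^sup>k\<close>\<close>

lemma partial_eqI: "(g has_derivative g') (at x) \<Longrightarrow> partial b g x = g' b"
  unfolding partial_def by (metis frechet_derivative_at)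

lemma has_derivative_partial:
  fixes g :: "'a::euclidean_space \<Rightarrow> real"
  assumes "g differentiable (at x)"
  shows "(g has_derivative (\<lambda>h. \<Sum>b\<in>Basis. partial b g x * (h \<bullet> b))) (at x)"
proof -
  let ?g = "frechet_derivative g (at x)"
  have d: "(g has_derivative ?g) (at x)"
    using assms frechet_derivative_works by blast
  interpret linear ?g
    using d has_derivative_linear by blast
  have "?g h = (\<Sum>b\<in>Basis. partial b g x * (h \<bullet> b))" for h
  proof -
    have "?g h = ?g (\<Sum>b\<in>Basis. (h \<bullet> b) *\<^sub>R b)"
      by (simp add: euclidean_representation)
    also have "\<dots> = (\<Sum>b\<in>Basis. partial b g x * (h \<bullet> b))"
      by (simp add: sum scaleR mult.commute partial_def)
    finally show ?thesis .
  qed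
  then have "?g = (\<lambda>h. \<Sum>b\<in>Basis. partial b g x * (h \<bullet> b))"
    by blast
  with d show ?thesis by metis
qed

lemma differentiable_cong_open:
  assumes "open S" "x \<in> S" "\<And>y. y \<in> S \<Longrightarrow> f y = g y" "f differentiable (at x)"
  shows "g differentiable (at x)"
  using assms has_derivative_transform_within_open unfolding differentiable_def by blast

lemma partial_cong_open:
  assumes "open S" "x \<in> S" "\<And>y. y \<in> S \<Longrightarrow> f y = g y"
  shows "partial b f x = partial b g x"
proof -
  have "(f has_derivative D) (at x) \<longleftrightarrow> (g has_derivative D) (at x)" for D
    using has_derivative_transform_within_open[of f D x UNIV S g]
      has_derivative_transform_within_open[of g D x UNIV S f] assms by auto
  then show ?thesis
    unfolding partial_def frechet_derivative_def by simp
qed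

text \<open>
  Partial derivatives are total functions, with unspecified values where the derivative does not
  exist. On an open set they depend only on the values there, which allows replacing them by explicit
  formulas valid on that set only.
\<close>

lemma Ck_on_cong:
  assumes "open S" "\<And>y. y \<in> S \<Longrightarrow> f y = g y" "Ck_on k f S"
  shows "Ck_on k g S"
  using assms
proof (induction k arbitrary: f g)
  case 0
  then show ?case using continuous_on_cong by force
next
  case (Suc k)
  have "Ck_on k (partial b g) S" if "b \<in> Basis" for b
    using Suc.IH[of "partial b f" "partial b g"] Suc.prems partial_cong_open[of S _ f g b] that
    by auto
  then show ?case
    using Suc.prems differentiable_cong_open[of S _ f g] by auto
qed

lemma Ck_on_Suc_imp:
  assumes "open S" "Ck_on (Suc k) f S"
  shows "Ck_on k f S"
  using assms
proof (induction k arbitrary: f)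
  case 0
  then show ?case
    by (auto intro!: continuous_at_imp_continuous_on differentiable_imp_continuous_within)
next
  case (Suc k)
  then show ?case by auto
qed

lemma Ck_on_has_derivative:
  assumes "Ck_on (Suc k) f S" "x \<in> S"
  shows "(f has_derivative frechet_derivative f (at x)) (at x)"
  using assms frechet_derivative_works[of f "at x"] by simp

lemma Ck_on_const [simp]: "Ck_on k (\<lambda>x. c) S"
proof (induction k arbitrary: c)
  case (Suc k)
  have "partial b (\<lambda>x. c) = (\<lambda>x. 0)" for b :: 'a
    by (rule ext, rule partial_eqI) (rule has_derivative_const)
  with Suc show ?case by simp
qed simp

lemma Ck_on_bounded_linear:
  assumes "bounded_linear L"
  shows "Ck_on k L S"
proof (cases k)
  case 0
  then show ?thesis
    using assms linear_continuous_on by simp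
next
  case (Suc k')
  have d: "(L has_derivative L) (at x)" for x
    using assms bounded_linear_imp_has_derivative by blast
  then have "partial b L = (\<lambda>x. L b)" for b
    by (intro ext partial_eqI)
  with Suc d show ?thesis
    by (auto simp: differentiable_def)
qed

lemma Ck_on_add:
  assumes "open S" "Ck_on k f S" "Ck_on k g S"
  shows "Ck_on k (\<lambda>x. f x + g x) S"
  using assms(2,3)
proof (induction k arbitrary: f g)
  case 0
  then show ?case by (simp add: continuous_on_add)
next
  case (Suc k)
  have "Ck_on k (partial b (\<lambda>x. f x + g x)) S" if "b \<in> Basis" for b
  proof (rule Ck_on_cong[OF assms(1)])
    show "Ck_on k (\<lambda>x. partial b f x + partial b g x) S"
      using Suc that by simp
    show "partial b f x + partial b g x = partial b (\<lambda>x. f x + g x) x" if "x \<in> S" for x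
    proof -
      from partial_eqI[OF has_derivative_add[OF Suc.prems[THEN Ck_on_has_derivative, OF that]]]
      show ?thesis
        by (simp add: partial_def)
    qed
  qed
  with Suc.prems show ?case by auto
qed

lemma Ck_on_sum:
  assumes "open S" "\<And>i. i \<in> I \<Longrightarrow> Ck_on k (f i) S"
  shows "Ck_on k (\<lambda>x. \<Sum>i\<in>I. f i x) S"
  using assms(2) by (induction I rule: infinite_finite_induct) (auto intro: Ck_on_add[OF assms(1)])

lemma Ck_on_mult:
  assumes "open S" "Ck_on k f S" "Ck_on k g S"
  shows "Ck_on k (\<lambda>x. f x * g x) S"
  using assms(2,3)
proof (induction k arbitrary: f g)
  case 0
  then show ?case by (simp add: continuous_on_mult)
next
  case (Suc k)
  have "Ck_on k (partial b (\<lambda>x. f x * g x)) S" if "b \<in> Basis" for b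
  proof (rule Ck_on_cong[OF assms(1)])
    show "Ck_on k (\<lambda>x. f x * partial b g x + partial b f x * g x) S"
      using Suc.prems that Suc.prems[THEN Ck_on_Suc_imp[OF assms(1)]]
      by (intro Ck_on_add[OF assms(1)] Suc.IH) simp_all
    show "f x * partial b g x + partial b f x * g x = partial b (\<lambda>x. f x * g x) x" if "x \<in> S" for x
    proof -
      from partial_eqI[OF has_derivative_mult[OF Suc.prems[THEN Ck_on_has_derivative, OF that]]]
      show ?thesis
        by (simp add: partial_def)
    qed
  qed
  with Suc.prems show ?case by auto
qed

lemma Ck_on_inverse:
  assumes "open S" "Ck_on k f S" "\<And>x. x \<in> S \<Longrightarrow> f x \<noteq> 0"
  shows "Ck_on k (\<lambda>x. inverse (f x)) S"
  using assms(2)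
proof (induction k)
  case 0
  then show ?case using assms(3) by (simp add: continuous_on_inverse)
next
  case (Suc k)
  have "Ck_on k f S"
    using Suc.prems Ck_on_Suc_imp assms(1) by blast
  then have inv: "Ck_on k (\<lambda>x. inverse (f x)) S"
    using Suc.IH by blast
  have deriv: "((\<lambda>x. inverse (f x)) has_derivative
      (\<lambda>h. - (inverse (f x) * frechet_derivative f (at x) h * inverse (f x)))) (at x)"
    if "x \<in> S" for x
    by (intro Deriv.has_derivative_inverse assms(3) Ck_on_has_derivative[OF Suc.prems] that)
  have "Ck_on k (partial b (\<lambda>x. inverse (f x))) S" if "b \<in> Basis" for b
  proof (rule Ck_on_cong[OF assms(1)])
    show "Ck_on k (\<lambda>x. (- 1) * (inverse (f x) * partial b f x * inverse (f x))) S"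
      using Suc.prems that inv by (intro Ck_on_mult[OF assms(1)]) auto
    show "(- 1) * (inverse (f x) * partial b f x * inverse (f x)) = partial b (\<lambda>x. inverse (f x)) x"
      if "x \<in> S" for x
      using partial_eqI[OF deriv[OF that], of b] by (simp add: partial_def)
  qed
  moreover have "(\<lambda>x. inverse (f x)) differentiable (at x)" if "x \<in> S" for x
    using deriv[OF that] unfolding differentiable_def by blast
  ultimately show ?case by auto
qed

lemma Ck_on_norm_power2:
  assumes "open S"
  shows "Ck_on k (\<lambda>x::'a::euclidean_space. (norm x)\<^sup>2) S"
proof (rule Ck_on_cong[OF assms])
  show "Ck_on k (\<lambda>x::'a. \<Sum>b\<in>Basis. (x \<bullet> b) * (x \<bullet> b)) S"
    by (intro Ck_on_sum Ck_on_mult assms Ck_on_bounded_linear bounded_linear_inner_left)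
  show "(\<Sum>b\<in>Basis. (x \<bullet> b) * (x \<bullet> b)) = (norm x)\<^sup>2" for x :: 'a
    by (simp add: power2_norm_eq_inner euclidean_inner[symmetric])
qed

section \<open>Horizontally conformal quadratic maps\<close>

text \<open>
  Polarisation gives \<open>L\<^sup>* L = r\<^sup>2 I\<close>. In finite dimension \<open>L\<close> is then
  onto unless \<open>r = 0\<close>, so the adjoint is a multiple of a two-sided inverse.
\<close>

lemma scaled_isometry_adjoint:
  fixes L :: "'a::euclidean_space \<Rightarrow> 'a"
  assumes "linear L" "\<And>x. norm (L x) = r * norm x"
  shows "L (adjoint L y) = r\<^sup>2 *\<^sub>R y"
proof (cases "r = 0")
  case True
  then show ?thesis using assms by simp
next
  case False
  interpret linear L by fact
  have "inner (L x) (L y) = r\<^sup>2 * inner x y" for x y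
    using assms(2)[of x] assms(2)[of y] assms(2)[of "x + y"]
    by (simp add: dot_norm add[symmetric] power_mult_distrib algebra_simps)
  then have "adjoint L (L x) = r\<^sup>2 *\<^sub>R x" for x
    by (metis (no_types, lifting) adjoint_works assms(1) inner_commute inner_scaleR_left vector_eq_rdot)
  moreover have "inj L"
    using assms(2) False by (metis (no_types, opaque_lifting) injI diff mult_eq_0_iff norm_eq_zero right_minus_eq)
  then have "surj L"
    using assms(1) linear_inj_imp_surj by blast
  then obtain x where "y = L x" by blast
  ultimately show ?thesis by (simp add: scaleR)
qed

lemma sum_Basis_prod:
  fixes f :: "'a::euclidean_space \<times> 'b::euclidean_space \<Rightarrow> 'c::comm_monoid_add"
  shows "sum f Basis = (\<Sum>u\<in>Basis. f (u, 0)) + (\<Sum>v\<in>Basis. f (0, v))"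
  unfolding Basis_prod_def
  by (subst sum.union_disjoint) (auto simp: sum.reindex inj_on_def)

text \<open>
  The first component of a point over \<open>(w, t)\<close> has squared norm \<open>(r + t) / 2\<close>, where \<open>r\<close> is the norm
  of \<open>(w, t)\<close>; with \<open>n = |w|\<close>, the second component has norm \<open>n / (2 sqrt ((r + t) / 2))\<close>.
  Replacing \<open>t\<close> by \<open>-t\<close> exchanges the roles of the two components.
\<close>

lemma hopf_radius_identity:
  fixes n t r :: real
  assumes "r\<^sup>2 = n\<^sup>2 + t\<^sup>2" "r + t > 0"
  shows "(sqrt ((r + t) / 2))\<^sup>2 - (n / (2 * sqrt ((r + t) / 2)))\<^sup>2 = t"
proof -
  have "n\<^sup>2 = (r + t) * (r - t)"
    using assms(1) by (simp add: power2_eq_square algebra_simps)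
  then have "(n / (2 * sqrt ((r + t) / 2)))\<^sup>2 = (r - t) / 2"
    using assms(2) by (simp add: power_divide power_mult_distrib field_simps)
  then show ?thesis
    using assms(2) by (simp add: field_simps)
qed

text \<open>
  The parameters \<open>m\<close> and \<open>c\<close> are product and conjugation. Only the pairing \<open>m (c x) y\<close> enters the
  Hopf map, so the assumptions are made on it.
\<close>

locale hopf_pairing =
  fixes m :: "'k::euclidean_space \<Rightarrow> 'k \<Rightarrow> 'k" and c :: "'k \<Rightarrow> 'k"
  assumes bilinear: "bounded_bilinear (\<lambda>x y. m (c x) y)"
    and norm_pairing: "norm (m (c x) y) = norm x * norm y"
begin

sublocale B: bounded_bilinear "\<lambda>x y. m (c x) y"
  by (rule bilinear)

text \<open>
  The differential of the Hopf map. It is linear in the direction \<open>h\<close> and, the map being quadratic,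
  in the base point \<open>z\<close> as well.
\<close>

definition dhopf :: "'k \<times> 'k \<Rightarrow> 'k \<times> 'k \<Rightarrow> 'k \<times> real" where
  "dhopf z h = (2 *\<^sub>R (m (c (fst z)) (snd h) + m (c (fst h)) (snd z)),
     2 * (fst z \<bullet> fst h - snd z \<bullet> snd h))"

lemma norm_hopf: "norm (hopf m c z) = (norm z)\<^sup>2"
proof -
  have "(norm (hopf m c z))\<^sup>2 = ((norm z)\<^sup>2)\<^sup>2"
    by (simp add: hopf_def norm_Pair norm_pairing norm_prod_def power2_eq_square algebra_simps
        flip: power2_eq_square) (simp add: power2_eq_square algebra_simps)
  then show ?thesis
    by (rule power2_eq_imp_eq) simp_all
qed

lemma bounded_linear_dhopf: "bounded_linear (dhopf z)" "bounded_linear (\<lambda>z. dhopf z h)"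
  unfolding dhopf_def
  by (auto intro!: bounded_linear_intros B.bounded_linear_left[THEN bounded_linear_compose]
      B.bounded_linear_right[THEN bounded_linear_compose])

lemma has_derivative_hopf: "(hopf m c has_derivative dhopf z) (at z)"
  unfolding hopf_def[abs_def] dhopf_def power2_norm_eq_inner
  by (rule derivative_eq_intros B.FDERIV refl | simp add: fun_eq_iff inner_commute algebra_simps scaleR_2)+

definition dhopf_adjoint :: "'k \<times> 'k \<Rightarrow> 'k \<times> real \<Rightarrow> 'k \<times> 'k" where
  "dhopf_adjoint z y =
     (2 *\<^sub>R adjoint (\<lambda>h. m (c h) (snd z)) (fst y) + (2 * snd y) *\<^sub>R fst z,
      2 *\<^sub>R adjoint (\<lambda>h. m (c (fst z)) h) (fst y) - (2 * snd y) *\<^sub>R snd z)"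

lemma linear_pairing: "linear (\<lambda>h. m (c h) y)" "linear (\<lambda>h. m (c x) h)"
  using B.bounded_linear_left B.bounded_linear_right bounded_linear.linear by blast+

lemma pairing_adjoint:
  "m (c (adjoint (\<lambda>h. m (c h) y) w)) y = (norm y)\<^sup>2 *\<^sub>R w"
  "m (c x) (adjoint (\<lambda>h. m (c x) h) w) = (norm x)\<^sup>2 *\<^sub>R w"
  using scaled_isometry_adjoint[OF linear_pairing(1), of y "norm y"]
    scaled_isometry_adjoint[OF linear_pairing(2), of x "norm x"]
  by (simp_all add: norm_pairing mult.commute)

lemma dhopf_adjoint: "dhopf z h \<bullet> y = h \<bullet> dhopf_adjoint z y"
  by (simp add: dhopf_def dhopf_adjoint_def inner_prod_def inner_add inner_diff
      adjoint_works[OF linear_pairing(1)] adjoint_works[OF linear_pairing(2)] inner_commute algebra_simps)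

text \<open>
  With \<open>R = B(-, z\<^sub>2)\<close> and \<open>L = B(z\<^sub>1, -)\<close>, the adjoint of the differential sends \<open>(w, t)\<close>
  to \<open>2 (R\<^sup>* w + t z\<^sub>1, L\<^sup>* w - t z\<^sub>2)\<close>. The diagonal terms add up because
  \<open>R R\<^sup>* = |z\<^sub>2|\<^sup>2\<close> and \<open>L L\<^sup>* = |z\<^sub>1|\<^sup>2\<close>; the mixed terms cancel because both
  \<open>z\<^sub>1 \<bullet> R\<^sup>* w\<close> and \<open>z\<^sub>2 \<bullet> L\<^sup>* w\<close> equal \<open>B(z\<^sub>1, z\<^sub>2) \<bullet> w\<close>.
\<close>

lemma dhopf_dhopf_adjoint: "dhopf z (dhopf_adjoint z y) = (4 * (norm z)\<^sup>2) *\<^sub>R y"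
proof (rule prod_eqI)
  let ?p = "adjoint (\<lambda>h. m (c h) (snd z)) (fst y)"
  let ?q = "adjoint (\<lambda>h. m (c (fst z)) h) (fst y)"
  have nz: "(norm z)\<^sup>2 = (norm (fst z))\<^sup>2 + (norm (snd z))\<^sup>2"
    by (simp add: norm_prod_def)
  show "fst (dhopf z (dhopf_adjoint z y)) = fst ((4 * (norm z)\<^sup>2) *\<^sub>R y)"
    by (simp add: dhopf_def dhopf_adjoint_def B.add_left B.add_right B.diff_right B.scaleR_left
        B.scaleR_right pairing_adjoint nz algebra_simps)
  have "fst z \<bullet> ?p = snd z \<bullet> ?q"
    by (simp add: adjoint_works[OF linear_pairing(1)] adjoint_works[OF linear_pairing(2)])
  then show "snd (dhopf z (dhopf_adjoint z y)) = snd ((4 * (norm z)\<^sup>2) *\<^sub>R y)"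
    unfolding nz by (simp add: dhopf_def dhopf_adjoint_def inner_add inner_diff
        power2_norm_eq_inner[of "fst z"] power2_norm_eq_inner[of "snd z"] algebra_simps)
qed

text \<open>
  Horizontal conformality: the gradients of the components form an orthogonal system of vectors of
  length \<open>2 |z|\<close>. This is \<open>D D\<^sup>* = 4 |z|\<^sup>2 I\<close> read in an orthonormal basis.
\<close>

lemma dhopf_conformal:
  "(\<Sum>b\<in>Basis. (dhopf z b \<bullet> x) * (dhopf z b \<bullet> y)) = 4 * (norm z)\<^sup>2 * (x \<bullet> y)"
proof -
  have *: "dhopf z b \<bullet> w = dhopf_adjoint z w \<bullet> b" for b w
    unfolding dhopf_adjoint by (rule inner_commute)
  have "(\<Sum>b\<in>Basis. (dhopf z b \<bullet> x) * (dhopf z b \<bullet> y)) = dhopf_adjoint z x \<bullet> dhopf_adjoint z y"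
    unfolding * by (rule euclidean_inner[symmetric])
  also have "\<dots> = 4 * (norm z)\<^sup>2 * (x \<bullet> y)"
    using dhopf_adjoint[of z "dhopf_adjoint z y" x]
    by (simp add: dhopf_dhopf_adjoint inner_commute)
  finally show ?thesis .
qed

text \<open>
  By linearity of \<open>dhopf\<close> in the base point, the sum is the Laplacian of the Hopf map. The pairing
  has no pure second derivatives, and in the last component the two factors contribute opposite
  amounts, their dimensions being equal.
\<close>

lemma hopf_harmonic: "(\<Sum>b\<in>Basis. dhopf b b) = 0"
proof (rule prod_eqI)
  show "fst (\<Sum>b\<in>Basis. dhopf b b) = fst 0"
    by (simp add: sum_Basis_prod fst_sum dhopf_def B.zero_left B.zero_right)
  show "snd (\<Sum>b\<in>Basis. dhopf b b) = snd 0"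
    by (simp add: sum_Basis_prod snd_sum dhopf_def sum_negf)
qed

section \<open>Pulling functions back\<close>

lemma has_derivative_comp_hopf:
  assumes "v differentiable (at (hopf m c z))"
  shows "(v \<circ> hopf m c has_derivative
      (\<lambda>h. \<Sum>j\<in>Basis. partial j v (hopf m c z) * (dhopf z h \<bullet> j))) (at z)"
  using diff_chain_at[OF has_derivative_hopf has_derivative_partial[OF assms]]
  by (simp add: o_def)

lemma differentiable_comp_hopf:
  fixes v :: "'k \<times> real \<Rightarrow> real"
  shows "v differentiable (at (hopf m c z)) \<Longrightarrow> (v \<circ> hopf m c) differentiable (at z)"
  by (rule differentiableI) (rule has_derivative_comp_hopf)

lemmas partial_comp_hopf = partial_eqI[OF has_derivative_comp_hopf]

text \<open>
  The chain rule solved for the derivatives downstairs: pairing the gradient of \<open>v \<circ> \<pi>\<close> with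
  that of the \<open>j\<close>-th component of \<open>\<pi>\<close> isolates \<open>\<partial>\<^sub>j v\<close>. It serves both the Laplacian identity and
  the descent of regularity.
\<close>

lemma partial_from_pullback:
  assumes "v differentiable (at (hopf m c z))" "j \<in> Basis"
  shows "(\<Sum>b\<in>Basis. partial b (v \<circ> hopf m c) z * (dhopf z b \<bullet> j))
    = 4 * (norm z)\<^sup>2 * partial j v (hopf m c z)"
proof -
  have "(\<Sum>b\<in>Basis. partial b (v \<circ> hopf m c) z * (dhopf z b \<bullet> j))
      = (\<Sum>b\<in>Basis. \<Sum>i\<in>Basis. partial i v (hopf m c z) * ((dhopf z b \<bullet> i) * (dhopf z b \<bullet> j)))"
    by (simp add: partial_comp_hopf[OF assms(1)] sum_distrib_right mult.assoc)
  also have "\<dots> = (\<Sum>i\<in>Basis. partial i v (hopf m c z) * (4 * (norm z)\<^sup>2 * (i \<bullet> j)))"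
    by (subst sum.swap) (simp add: dhopf_conformal flip: sum_distrib_left)
  also have "\<dots> = 4 * (norm z)\<^sup>2 * partial j v (hopf m c z)"
    using assms(2) by (simp add: inner_Basis if_distrib[of "\<lambda>x. _ * x"] cong: if_cong)
  finally show ?thesis .
qed

lemma Ck_on_dhopf: "Ck_on k (\<lambda>z. dhopf z h \<bullet> j) S"
  by (intro Ck_on_bounded_linear bounded_linear_compose[OF bounded_linear_inner_left]
      bounded_linear_dhopf)

lemma continuous_on_hopf: "continuous_on S (hopf m c)"
  by (meson continuous_at_imp_continuous_on has_derivative_continuous has_derivative_hopf)

lemma open_vimage_hopf: "open U \<Longrightarrow> open (hopf m c -` U)"
  using continuous_on_hopf open_vimage by blast

lemma Ck_on_comp_hopf:
  assumes "open U" "Ck_on k v U"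
  shows "Ck_on k (v \<circ> hopf m c) (hopf m c -` U)"
  using assms(2)
proof (induction k arbitrary: v)
  case 0
  then show ?case
    unfolding Ck_on.simps
    by (intro continuous_on_compose continuous_on_hopf) (auto elim: continuous_on_subset)
next
  case (Suc k)
  let ?\<Omega> = "hopf m c -` U"
  have op: "open ?\<Omega>"
    using assms(1) by (rule open_vimage_hopf)
  have "Ck_on k (partial b (v \<circ> hopf m c)) ?\<Omega>" for b
  proof (rule Ck_on_cong[OF op])
    show "Ck_on k (\<lambda>z. \<Sum>j\<in>Basis. (partial j v \<circ> hopf m c) z * (dhopf z b \<bullet> j)) ?\<Omega>"
      using Suc by (intro Ck_on_sum Ck_on_mult Ck_on_dhopf op) auto
    show "(\<Sum>j\<in>Basis. (partial j v \<circ> hopf m c) z * (dhopf z b \<bullet> j)) = partial b (v \<circ> hopf m c) z"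
      if "z \<in> ?\<Omega>" for z
      using Suc.prems that by (simp add: partial_comp_hopf)
  qed
  moreover have "(v \<circ> hopf m c) differentiable (at z)" if "z \<in> ?\<Omega>" for z
    using Suc.prems that by (intro differentiable_comp_hopf) auto
  ultimately show ?case unfolding Ck_on.simps by blast
qed

text \<open>
  Differentiating the chain rule once more gives two kinds of terms. Those with first derivatives of
  \<open>v\<close> carry the Laplacian of \<open>\<pi>\<close> and vanish; those with second derivatives are the
  sums to which \<open>partial_from_pullback\<close> applies, with \<open>\<partial>\<^sub>j v\<close> in place of \<open>v\<close>.
\<close>

lemma laplacian_comp_hopf:
  assumes "open U" "Ck_on 2 v U" "hopf m c z \<in> U"
  shows "laplacian (v \<circ> hopf m c) z = 4 * (norm z)\<^sup>2 * laplacian v (hopf m c z)"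
proof -
  let ?\<pi> = "hopf m c" and ?\<Omega> = "hopf m c -` U"
  have op: "open ?\<Omega>"
    using assms(1) by (rule open_vimage_hopf)
  have C: "\<And>x. x \<in> U \<Longrightarrow> v differentiable (at x)"
    "\<And>x j. x \<in> U \<Longrightarrow> j \<in> Basis \<Longrightarrow> partial j v differentiable (at x)"
    using assms(2) by (auto simp: numeral_2_eq_2)
  have second: "partial b (partial b (v \<circ> ?\<pi>)) z =
      (\<Sum>j\<in>Basis. partial j v (?\<pi> z) * (dhopf b b \<bullet> j)
        + partial b (partial j v \<circ> ?\<pi>) z * (dhopf z b \<bullet> j))" for b
  proof -
    have "((\<lambda>z. dhopf z b \<bullet> j) has_derivative (\<lambda>h. dhopf h b \<bullet> j)) (at z)" for j
      by (intro bounded_linear_imp_has_derivative bounded_linear_compose[OF bounded_linear_inner_left]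
          bounded_linear_dhopf)
    moreover have "(partial j v \<circ> ?\<pi> has_derivative frechet_derivative (partial j v \<circ> ?\<pi>) (at z)) (at z)"
      if "j \<in> Basis" for j
      using differentiable_comp_hopf[OF C(2)[OF assms(3) that]] frechet_derivative_works by blast
    ultimately have "((\<lambda>z. \<Sum>j\<in>Basis. (partial j v \<circ> ?\<pi>) z * (dhopf z b \<bullet> j)) has_derivative
        (\<lambda>h. \<Sum>j\<in>Basis. (partial j v \<circ> ?\<pi>) z * (dhopf h b \<bullet> j)
          + frechet_derivative (partial j v \<circ> ?\<pi>) (at z) h * (dhopf z b \<bullet> j))) (at z)"
      by (intro has_derivative_sum has_derivative_mult)
    from partial_eqI[OF this, of b] have "partial b (\<lambda>z. \<Sum>j\<in>Basis. (partial j v \<circ> ?\<pi>) z * (dhopf z b \<bullet> j)) z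
      = (\<Sum>j\<in>Basis. partial j v (?\<pi> z) * (dhopf b b \<bullet> j)
          + partial b (partial j v \<circ> ?\<pi>) z * (dhopf z b \<bullet> j))"
      by (simp add: partial_def)
    moreover have "partial b (partial b (v \<circ> ?\<pi>)) z
        = partial b (\<lambda>z. \<Sum>j\<in>Basis. (partial j v \<circ> ?\<pi>) z * (dhopf z b \<bullet> j)) z"
      using assms(3) C(1) by (intro partial_cong_open[OF op]) (auto simp: partial_comp_hopf)
    ultimately show ?thesis by simp
  qed
  have "laplacian (v \<circ> ?\<pi>) z
      = (\<Sum>j\<in>Basis. partial j v (?\<pi> z) * ((\<Sum>b\<in>Basis. dhopf b b) \<bullet> j))
      + (\<Sum>j\<in>Basis. \<Sum>b\<in>Basis. partial b (partial j v \<circ> ?\<pi>) z * (dhopf z b \<bullet> j))"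
    unfolding laplacian_def second
    by (subst sum.swap) (simp add: sum.distrib inner_sum_left sum_distrib_left)
  also have "\<dots> = (\<Sum>j\<in>Basis. 4 * (norm z)\<^sup>2 * partial j (partial j v) (?\<pi> z))"
    using C(2)[OF assms(3)] by (simp add: hopf_harmonic partial_from_pullback)
  finally show ?thesis
    by (simp add: laplacian_def sum_distrib_left)
qed

section \<open>Functions on the base inherit regularity\<close>

text \<open>
  The two components of the local sections below; the sign \<open>\<sigma> = 1\<close> is used off the ray
  \<open>t = -|x|\<close> and \<open>\<sigma> = -1\<close> off the ray \<open>t = |x|\<close>.
\<close>

lemma differentiable_section_parts:
  fixes x :: "'k \<times> real" and L :: "'k \<Rightarrow> 'k"
  assumes "x \<noteq> 0" "norm x + \<sigma> * snd x > 0" "bounded_linear L"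
  defines "\<rho> \<equiv> (\<lambda>y::'k \<times> real. sqrt ((norm y + \<sigma> * snd y) / 2))"
  shows "(\<lambda>y. \<rho> y *\<^sub>R e) differentiable (at x)"
    and "(\<lambda>y. (1 / (2 * \<rho> y)) *\<^sub>R L (fst y)) differentiable (at x)"
proof -
  obtain D where "(norm has_derivative D) (at x)"
    using differentiable_norm_at[OF assms(1)] unfolding differentiable_def by blast
  then have \<rho>: "\<rho> differentiable (at x)"
    unfolding \<rho>_def differentiable_def using assms(2)
    by (auto intro!: exI derivative_eq_intros)
  then show "(\<lambda>y. \<rho> y *\<^sub>R e) differentiable (at x)"
    by simp
  have "(\<lambda>y. L (fst y)) differentiable (at x)"
    by (intro bounded_linear_imp_differentiable bounded_linear_compose[OF assms(3)] bounded_linear_fst)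
  moreover have "(\<lambda>y. 1 / (2 * \<rho> y)) differentiable (at x)"
    using \<rho> assms(2) by (intro differentiable_divide) (auto simp: \<rho>_def)
  ultimately show "(\<lambda>y. (1 / (2 * \<rho> y)) *\<^sub>R L (fst y)) differentiable (at x)"
    by (rule differentiable_scaleR[rotated])
qed

text \<open>
  A point over \<open>(w, t)\<close> is found by prescribing the direction \<open>e\<close> of one component: its length is
  then determined by \<open>|z\<^sub>1|\<^sup>2 - |z\<^sub>2|\<^sup>2 = t\<close> and \<open>|z|\<^sup>2 = |(w, t)|\<close>, and the other
  component is obtained by inverting multiplication by \<open>e\<close>. Prescribing \<open>z\<^sub>1\<close> fails where
  \<open>z\<^sub>1 = 0\<close>, that is for \<open>t = -|(w, t)|\<close>; there \<open>z\<^sub>2\<close> is prescribed instead.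
\<close>

lemma hopf_local_section:
  assumes "x \<noteq> 0"
  obtains s V where "open V" "x \<in> V" "\<And>y. y \<in> V \<Longrightarrow> hopf m c (s y) = y" "s differentiable (at x)"
proof -
  obtain e :: 'k where e: "norm e = 1"
    by (meson norm_Basis SOME_Basis)
  have ny: "(norm y)\<^sup>2 = (norm (fst y))\<^sup>2 + (\<sigma> * snd y)\<^sup>2"
    if "\<sigma> = 1 \<or> \<sigma> = - 1" for y :: "'k \<times> real" and \<sigma> :: real
    using that by (auto simp: norm_prod_def)
  define V where "V = (\<lambda>\<sigma>. {y::'k \<times> real. norm y + \<sigma> * snd y > 0})"
  define \<rho> where "\<rho> = (\<lambda>\<sigma> (y::'k \<times> real). sqrt ((norm y + \<sigma> * snd y) / 2))"
  have V: "open (V \<sigma>)" for \<sigma>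
    unfolding V_def by (intro open_Collect_less continuous_intros)
  have \<rho>: "\<rho> \<sigma> y > 0" "(\<rho> \<sigma> y)\<^sup>2 - (norm (fst y) / (2 * \<rho> \<sigma> y))\<^sup>2 = \<sigma> * snd y"
    if "y \<in> V \<sigma>" "\<sigma> = 1 \<or> \<sigma> = - 1" for y \<sigma>
    using hopf_radius_identity[OF ny, of \<sigma> y] that by (auto simp: V_def \<rho>_def)
  have "norm x > 0"
    using assms by simp
  then consider (plus) "x \<in> V 1" | (minus) "x \<in> V (- 1)"
    unfolding V_def mem_Collect_eq by linarith
  then show thesis
  proof cases
    case plus
    define L where "L = adjoint (\<lambda>h. m (c e) h)"
    have L: "m (c e) (L w) = w" for w
      using e by (simp add: L_def pairing_adjoint)
    then have nL: "norm (L w) = norm w" for w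
      using norm_pairing[of e "L w"] e by simp
    have blL: "bounded_linear L"
      unfolding L_def by (intro linear_conv_bounded_linear[THEN iffD1] adjoint_linear linear_pairing)
    define s where "s = (\<lambda>y. (\<rho> 1 y *\<^sub>R e, (1 / (2 * \<rho> 1 y)) *\<^sub>R L (fst y)))"
    have "hopf m c (s y) = y" if "y \<in> V 1" for y
      using \<rho>[OF that] by (intro prod_eqI)
        (simp_all add: hopf_def s_def B.scaleR_left B.scaleR_right L nL e)
    moreover have "s differentiable (at x)"
      using differentiable_section_parts[OF assms _ blL, of 1] plus
      unfolding s_def \<rho>_def V_def by (intro differentiable_Pair) auto
    ultimately show thesis
      using that V plus by blast
  next
    case minus
    define L where "L = adjoint (\<lambda>h. m (c h) e)"
    have L: "m (c (L w)) e = w" for w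
      using e by (simp add: L_def pairing_adjoint)
    then have nL: "norm (L w) = norm w" for w
      using norm_pairing[of "L w" e] e by simp
    have blL: "bounded_linear L"
      unfolding L_def by (intro linear_conv_bounded_linear[THEN iffD1] adjoint_linear linear_pairing)
    define s where "s = (\<lambda>y. ((1 / (2 * \<rho> (- 1) y)) *\<^sub>R L (fst y), \<rho> (- 1) y *\<^sub>R e))"
    have "hopf m c (s y) = y" if "y \<in> V (- 1)" for y
      using \<rho>[OF that] by (intro prod_eqI)
        (simp_all add: hopf_def s_def B.scaleR_left B.scaleR_right L nL e)
    moreover have "s differentiable (at x)"
      using differentiable_section_parts[OF assms _ blL, of "- 1"] minus
      unfolding s_def \<rho>_def V_def by (intro differentiable_Pair) auto
    ultimately show thesis
      using that V minus by blast
  qed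
qed

lemma surj_hopf: "surj (hopf m c)"
proof -
  have "\<exists>z. x = hopf m c z" for x
  proof (cases "x = 0")
    case True
    then have "x = hopf m c 0"
      by (simp add: hopf_def B.zero_right zero_prod_def)
    then show ?thesis ..
  next
    case False
    then show ?thesis using hopf_local_section[of x] by metis
  qed
  then show ?thesis by blast
qed

text \<open>
  Near \<open>x\<close> one has \<open>h = g \<circ> s\<close> for a local section \<open>s\<close>.
\<close>

lemma descend_regularity:
  assumes "open U" "0 \<notin> U" "\<And>z. hopf m c z \<in> U \<Longrightarrow> g z = h (hopf m c z)" "x \<in> U"
  shows "(\<And>z. hopf m c z \<in> U \<Longrightarrow> isCont g z) \<Longrightarrow> isCont h x"
    and "(\<And>z. hopf m c z \<in> U \<Longrightarrow> g differentiable (at z)) \<Longrightarrow> h differentiable (at x)"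
proof -
  have "x \<noteq> 0" using assms(2,4) by metis
  then obtain s V where sV: "open V" "x \<in> V" "\<And>y. y \<in> V \<Longrightarrow> hopf m c (s y) = y" "s differentiable (at x)"
    using hopf_local_section[of x] by metis
  have op: "open (U \<inter> V)" "x \<in> U \<inter> V"
    using assms(1,4) sV(1,2) by auto
  have eq: "(g \<circ> s) y = h y" if "y \<in> U \<inter> V" for y
    using that assms(3)[of "s y"] sV(3)[of y] by simp
  have sx: "hopf m c (s x) \<in> U"
    using sV assms(4) by simp
  show "isCont h x" if "\<And>z. hopf m c z \<in> U \<Longrightarrow> isCont g z"
  proof -
    have "isCont (g \<circ> s) x"
      using differentiable_imp_continuous_within[OF sV(4)] that[OF sx] by (rule continuous_at_compose)
    moreover have "\<forall>\<^sub>F y in nhds x. (g \<circ> s) y = h y"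
      using op eq unfolding eventually_nhds by blast
    ultimately show ?thesis
      using isCont_cong[of "g \<circ> s" h x] by blast
  qed
  show "h differentiable (at x)" if "\<And>z. hopf m c z \<in> U \<Longrightarrow> g differentiable (at z)"
    using differentiable_cong_open[OF op eq differentiable_chain_at[OF sV(4) that[OF sx]]] .
qed

text \<open>
  Each derivative \<open>\<partial>\<^sub>j h\<close>, composed with \<open>\<pi>\<close>, is a combination of the derivatives of \<open>g\<close> with
  smooth coefficients, by \<open>partial_from_pullback\<close>; the division by \<open>4 |z|\<^sup>2\<close> is possible since
  \<open>0 \<notin> U\<close>. So \<open>\<partial>\<^sub>j h\<close> again satisfies the hypotheses, with \<open>k\<close> lowered by one. In this way
  mere differentiability of the local sections suffices for all \<open>k\<close>.
\<close>

lemma Ck_on_descend: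
  assumes "open U" "0 \<notin> U" "Ck_on k g (hopf m c -` U)"
    "\<And>z. hopf m c z \<in> U \<Longrightarrow> g z = h (hopf m c z)"
  shows "Ck_on k h U"
  using assms(3,4)
proof (induction k arbitrary: g h)
  case 0
  then have "isCont g z" if "hopf m c z \<in> U" for z
    using that open_vimage_hopf[OF assms(1)] by (simp add: continuous_on_eq_continuous_at)
  then show ?case
    using descend_regularity(1)[OF assms(1,2), of g h] 0(2)
    by (auto intro!: continuous_at_imp_continuous_on)
next
  case (Suc k)
  let ?\<Omega> = "hopf m c -` U"
  have op: "open ?\<Omega>"
    using assms(1) by (rule open_vimage_hopf)
  have diff: "h differentiable (at x)" if "x \<in> U" for x
    using descend_regularity(2)[OF assms(1,2), of g h] Suc.prems that by auto
  have nz: "4 * (norm z)\<^sup>2 \<noteq> 0" if "hopf m c z \<in> U" for z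
    using that assms(2) norm_hopf[of z] by auto
  have "Ck_on k (partial j h) U" if j: "j \<in> Basis" for j
  proof (rule Suc.IH)
    show "Ck_on k (\<lambda>z. inverse (4 * (norm z)\<^sup>2) * (\<Sum>b\<in>Basis. partial b g z * (dhopf z b \<bullet> j))) ?\<Omega>"
      using Suc.prems(1) nz
      by (intro Ck_on_mult Ck_on_inverse Ck_on_sum Ck_on_dhopf Ck_on_norm_power2 Ck_on_const op) auto
    show "inverse (4 * (norm z)\<^sup>2) * (\<Sum>b\<in>Basis. partial b g z * (dhopf z b \<bullet> j)) = partial j h (hopf m c z)"
      if z: "hopf m c z \<in> U" for z
    proof -
      have "partial b g z = partial b (h \<circ> hopf m c) z" for b
        using Suc.prems(2) z by (intro partial_cong_open[OF op]) auto
      then show ?thesis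
        using partial_from_pullback[OF diff[OF z] j] nz[OF z] by simp
    qed
  qed
  with diff show ?case by simp
qed

section \<open>The Hopf map at the boundary\<close>

text \<open>
  The Hopf map is proper because \<open>|\<pi>(z)| = |z|\<^sup>2\<close>: preimages of a convergent sequence are bounded
  and therefore subconverge.
\<close>

lemma closed_image_hopf:
  assumes "closed S"
  shows "closed (hopf m c ` S)"
proof (rule closed_sequential_limits[THEN iffD2], intro allI impI, elim conjE)
  fix y l assume y: "\<forall>n. y n \<in> hopf m c ` S" and lim: "y \<longlonglongrightarrow> l"
  from y have "\<forall>n. \<exists>w. w \<in> S \<and> y n = hopf m c w"
    by blast
  then obtain z where z: "\<And>n. z n \<in> S" "\<And>n. y n = hopf m c (z n)"
    using choice by metis
  obtain B where "\<And>n. norm (y n) \<le> B"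
    using convergent_imp_Bseq[OF convergentI[OF lim]] by (elim BseqE) blast
  then have "norm (z n) \<le> sqrt B" for n
    by (simp add: z(2) norm_hopf real_le_rsqrt)
  then have "bounded (range z)"
    unfolding bounded_iff by blast
  then obtain z' r where r: "strict_mono (r::nat \<Rightarrow> nat)" "(z \<circ> r) \<longlonglongrightarrow> z'"
    using bounded_imp_convergent_subsequence[of z] by metis
  have "z' \<in> S"
    using closed_sequentially[OF assms _ r(2)] z(1) by simp
  moreover have "(\<lambda>n. hopf m c ((z \<circ> r) n)) \<longlonglongrightarrow> hopf m c z'"
    using isCont_tendsto_compose[OF has_derivative_continuous[OF has_derivative_hopf] r(2)] .
  moreover have "(\<lambda>n. hopf m c ((z \<circ> r) n)) \<longlonglongrightarrow> l"
    using LIMSEQ_subseq_LIMSEQ[OF lim r(1)] by (simp add: z(2) o_def)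
  ultimately show "l \<in> hopf m c ` S"
    using LIMSEQ_unique by blast
qed

text \<open>
  The image of the closure is closed by properness and contains \<open>U\<close> by surjectivity.
\<close>

lemma hopf_image_closure: "hopf m c ` closure (hopf m c -` U) = closure U"
proof
  have "closure (hopf m c -` U) \<subseteq> hopf m c -` closure U"
    using closure_subset[of U]
    by (intro closure_minimal closed_vimage continuous_on_hopf closed_closure) blast
  then show "hopf m c ` closure (hopf m c -` U) \<subseteq> closure U"
    by blast
  have "U \<subseteq> hopf m c ` closure (hopf m c -` U)"
    using image_mono[OF closure_subset[of "hopf m c -` U"], of "hopf m c"]
    by (simp only: surj_image_vimage_eq[OF surj_hopf])
  then show "closure U \<subseteq> hopf m c ` closure (hopf m c -` U)"
    by (intro closure_minimal closed_image_hopf) auto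
qed

text \<open>
  A closed map is a quotient map: the preimage of a closed set under \<open>v\<close> is the image of its
  preimage under \<open>u\<close>. This covers the origin too, which may lie on the boundary of \<open>U\<close> and has no
  local section.
\<close>

lemma continuous_on_closure_descend:
  assumes "continuous_on (closure (hopf m c -` U)) u"
    "\<forall>z\<in>closure (hopf m c -` U). u z = v (hopf m c z)"
  shows "continuous_on (closure U) (v::_ \<Rightarrow> real)"
proof (rule continuous_on_closed_vimage[THEN iffD2, rule_format])
  show "closed (closure U)" by simp
  fix A :: "real set" assume "closed A"
  then have "closed (u -` A \<inter> closure (hopf m c -` U))"
    using assms(1) continuous_on_closed_vimage[of "closure (hopf m c -` U)" u] by auto
  then have "closed (hopf m c ` (u -` A \<inter> closure (hopf m c -` U)))"
    by (rule closed_image_hopf)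
  moreover have "hopf m c ` (u -` A \<inter> closure (hopf m c -` U)) = v -` A \<inter> closure U"
    unfolding hopf_image_closure[of U, symmetric] using assms(2) by auto
  ultimately show "closed (v -` A \<inter> closure U)" by simp
qed

section \<open>Equivalence of the two Dirichlet problems\<close>

lemma solves_full_comp_hopf:
  assumes "open U" "0 \<notin> U" "solves_reduced a f U v"
  shows "solves_full a f (hopf m c -` U) (v \<circ> hopf m c)"
  unfolding solves_full_def
proof (intro conjI ballI)
  let ?\<Omega> = "hopf m c -` U"
  note v = assms(3)[unfolded solves_reduced_def]
  show "Ck_on 2 (v \<circ> hopf m c) ?\<Omega>"
    using v Ck_on_comp_hopf[OF assms(1)] by blast
  show "continuous_on (closure ?\<Omega>) (v \<circ> hopf m c)"
    using v by (intro continuous_on_compose continuous_on_hopf) (simp add: hopf_image_closure)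
  show "- laplacian (v \<circ> hopf m c) z + a * (v \<circ> hopf m c) z = f ((v \<circ> hopf m c) z)" if "z \<in> ?\<Omega>" for z
  proof -
    have z: "hopf m c z \<in> U" using that by simp
    then have "norm z \<noteq> 0"
      using assms(2) norm_hopf[of z] by auto
    moreover have "- laplacian v (hopf m c z) + a / (4 * (norm z)\<^sup>2) * v (hopf m c z)
        = 1 / (4 * (norm z)\<^sup>2) * f (v (hopf m c z))"
      using v z by (simp flip: norm_hopf)
    ultimately have "- (4 * (norm z)\<^sup>2 * laplacian v (hopf m c z)) + a * v (hopf m c z)
        = f (v (hopf m c z))"
      by (simp add: field_simps)
    then show ?thesis
      using laplacian_comp_hopf[OF assms(1) _ z] v by simp
  qed
  show "(v \<circ> hopf m c) z = 0" if "z \<in> frontier ?\<Omega>" for z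
  proof -
    have "hopf m c z \<in> closure U"
      using that hopf_image_closure[of U] by (auto simp: frontier_def)
    moreover have "hopf m c z \<notin> U"
      using that open_vimage_hopf[OF assms(1)] by (auto simp: frontier_def interior_open)
    ultimately show ?thesis
      using v assms(1) by (simp add: frontier_def interior_open)
  qed
qed

lemma solves_reduced_descend:
  assumes "open U" "0 \<notin> U" "solves_full a f (hopf m c -` U) u"
    "\<forall>z\<in>closure (hopf m c -` U). u z = v (hopf m c z)"
  shows "solves_reduced a f U v"
  unfolding solves_reduced_def
proof (intro conjI ballI)
  let ?\<Omega> = "hopf m c -` U"
  note u = assms(3)[unfolded solves_full_def]
  have op: "open ?\<Omega>"
    using assms(1) by (rule open_vimage_hopf)
  have eq: "u z = v (hopf m c z)" if "hopf m c z \<in> U" for z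
    using assms(4) closure_subset[of ?\<Omega>] that by blast
  show C2: "Ck_on 2 v U"
    using Ck_on_descend[OF assms(1,2), of 2 u v] eq u by blast
  show "continuous_on (closure U) v"
    using continuous_on_closure_descend u assms(4) by blast
  show "- laplacian v x + a / (4 * norm x) * v x = 1 / (4 * norm x) * f (v x)" if "x \<in> U" for x
  proof -
    obtain z where z: "x = hopf m c z"
      using surj_hopf by (metis surjD)
    have "laplacian u z = laplacian (v \<circ> hopf m c) z"
    proof -
      have "partial b (partial b u) z = partial b (partial b (v \<circ> hopf m c)) z" for b
        using eq that z
        by (intro partial_cong_open[OF op]) auto
      then show ?thesis by (simp add: laplacian_def)
    qed
    also have "\<dots> = 4 * norm x * laplacian v x"
      using laplacian_comp_hopf[OF assms(1) C2, of z] that z by (simp add: norm_hopf)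
    finally have "laplacian u z = 4 * norm x * laplacian v x" .
    moreover have "- laplacian u z + a * v x = f (v x)"
      using u that z eq[of z] by (metis vimageI2)
    moreover have "norm x \<noteq> 0"
      using that assms(2) by auto
    ultimately show ?thesis
      by (simp add: field_simps)
  qed
  show "v x = 0" if "x \<in> frontier U" for x
  proof -
    have "x \<in> hopf m c ` closure ?\<Omega>"
      unfolding hopf_image_closure using that by (simp add: frontier_def)
    then obtain z where z: "x = hopf m c z" "z \<in> closure ?\<Omega>"
      by (rule imageE)
    moreover have "z \<notin> ?\<Omega>"
      using that assms(1) z(1) by (simp add: frontier_def interior_open)
    ultimately show ?thesis
      using u op assms(4) by (simp add: frontier_def interior_open)
  qed
qed

lemma dirichlet_equivalence:
  assumes "bounded_smooth_domain U \<and> 0 \<notin> U"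
  shows "let \<pi> = hopf m c; \<Omega> = \<pi> -` U in
    (\<forall>v. solves_reduced a f U v \<longrightarrow> solves_full a f \<Omega> (v \<circ> \<pi>)) \<and>
    (\<forall>u v. solves_full a f \<Omega> u \<and> unit_invariant_on m (closure \<Omega>) u \<and>
       (\<forall>z\<in>closure \<Omega>. u z = v (\<pi> z)) \<longrightarrow> solves_reduced a f U v)"
  using assms solves_full_comp_hopf[of U] solves_reduced_descend[of U]
  unfolding Let_def bounded_smooth_domain_def by metis

end

section \<open>Norms on quaternions and octonions\<close>

lemma quat_mult_assoc: "quat_mult (quat_mult p q) r = quat_mult p (quat_mult q r)"
  by (simp add: quat_mult_def cd_mult_def algebra_simps)

lemma quat_cnj_cnj: "quat_cnj (quat_cnj p) = p"
  by (simp add: quat_cnj_def cd_cnj_def)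

lemma quat_inner_mult_left: "quat_mult p q \<bullet> r = q \<bullet> quat_mult (quat_cnj p) r"
  by (simp add: quat_mult_def quat_cnj_def cd_mult_def cd_cnj_def inner_prod_def inner_complex_def algebra_simps)

lemma quat_inner_mult_right: "quat_mult p q \<bullet> r = p \<bullet> quat_mult r (quat_cnj q)"
  by (simp add: quat_mult_def quat_cnj_def cd_mult_def cd_cnj_def inner_prod_def inner_complex_def algebra_simps)

text \<open>
  For \<open>(a, b)\<close> and \<open>(x, y)\<close>, expanding the squared norm of the product gives the four products of
  squared norms and two cross terms, \<open>-2 ax \<bullet> y\<^sup>*b\<close> and \<open>2 ya \<bullet> bx\<^sup>*\<close>. Moving factors across
  the inner product turns them into \<open>-2 y(ax) \<bullet> b\<close> and \<open>2 (ya)x \<bullet> b\<close>, so they cancel exactly by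
  associativity of \<open>m\<close>. The doubled algebra need not be associative.
\<close>

lemma norm_cd_mult:
  fixes m :: "'k::real_inner \<Rightarrow> 'k \<Rightarrow> 'k"
  assumes norm_m: "\<And>x y. norm (m x y) = norm x * norm y"
    and norm_c: "\<And>x. norm (c x) = norm x"
    and cc: "\<And>x. c (c x) = x"
    and assoc: "\<And>x y z. m (m x y) z = m x (m y z)"
    and left: "\<And>x y z. m x y \<bullet> z = y \<bullet> m (c x) z"
    and right: "\<And>x y z. m x y \<bullet> z = x \<bullet> m z (c y)"
  shows "norm (cd_mult m c p q) = norm p * norm q"
proof -
  obtain a b where p: "p = (a, b)" by (cases p)
  obtain x y where q: "q = (x, y)" by (cases q)
  have sq: "m u v \<bullet> m u v = (u \<bullet> u) * (v \<bullet> v)" "c u \<bullet> c u = u \<bullet> u" for u v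
    using norm_m[of u v] norm_c[of u] by (simp_all add: norm_eq_sqrt_inner real_sqrt_mult[symmetric])
  have "m a x \<bullet> m (c y) b = m y (m a x) \<bullet> b"
    by (simp add: left)
  also have "\<dots> = m y a \<bullet> m b (c x)"
    using right[of "m y a" x b] by (simp add: assoc)
  finally have cross: "m a x \<bullet> m (c y) b = m y a \<bullet> m b (c x)" .
  have "(norm (cd_mult m c p q))\<^sup>2 = (norm p * norm q)\<^sup>2"
    using cross
    by (simp add: p q cd_mult_def power_mult_distrib power2_norm_eq_inner inner_diff inner_add sq
        inner_commute algebra_simps)
  then show ?thesis
    by (rule power2_eq_imp_eq) simp_all
qed

lemma norm_quat_cnj: "norm (quat_cnj p) = norm p"
  by (simp add: quat_cnj_def cd_cnj_def norm_prod_def)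

lemma norm_oct_cnj: "norm (oct_cnj p) = norm p"
  by (simp add: oct_cnj_def cd_cnj_def norm_Pair norm_quat_cnj flip: norm_prod_def)

lemma norm_quat_mult: "norm (quat_mult p q) = norm p * norm q"
  unfolding quat_mult_def
  by (rule norm_cd_mult) (simp_all add: norm_mult inner_complex_def algebra_simps)

lemma norm_oct_mult: "norm (oct_mult p q) = norm p * norm q"
  unfolding oct_mult_def
  by (rule norm_cd_mult norm_quat_mult norm_quat_cnj quat_cnj_cnj quat_mult_assoc
      quat_inner_mult_left quat_inner_mult_right)+

lemma hopf_pairingI:
  assumes "\<And>x x' y. m (c (x + x')) y = m (c x) y + m (c x') y"
    and "\<And>x y y'. m x (y + y') = m x y + m x y'"
    and "\<And>r x y. m (c (r *\<^sub>R x)) y = r *\<^sub>R m (c x) y"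
    and "\<And>r x y. m x (r *\<^sub>R y) = r *\<^sub>R m x y"
    and "\<And>x y. norm (m x y) = norm x * norm y"
    and "\<And>x. norm (c x) = norm x"
  shows "hopf_pairing m c"
  by unfold_locales (auto simp: assms intro!: exI[of _ 1])

lemma quat_bilinear:
  "quat_mult (p + p') q = quat_mult p q + quat_mult p' q"
  "quat_mult p (q + q') = quat_mult p q + quat_mult p q'"
  "quat_mult (r *\<^sub>R p) q = r *\<^sub>R quat_mult p q"
  "quat_mult p (r *\<^sub>R q) = r *\<^sub>R quat_mult p q"
  "quat_cnj (p + q) = quat_cnj p + quat_cnj q"
  "quat_cnj (r *\<^sub>R p) = r *\<^sub>R quat_cnj p"
  by (simp_all add: quat_mult_def quat_cnj_def cd_mult_def cd_cnj_def algebra_simps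
      scaleR_conv_of_real)

lemma oct_bilinear:
  "oct_mult (p + p') q = oct_mult p q + oct_mult p' q"
  "oct_mult p (q + q') = oct_mult p q + oct_mult p q'"
  "oct_mult (r *\<^sub>R p) q = r *\<^sub>R oct_mult p q"
  "oct_mult p (r *\<^sub>R q) = r *\<^sub>R oct_mult p q"
  "oct_cnj (p + q) = oct_cnj p + oct_cnj q"
  "oct_cnj (r *\<^sub>R p) = r *\<^sub>R oct_cnj p"
  by (simp_all add: oct_mult_def oct_cnj_def cd_mult_def cd_cnj_def quat_bilinear algebra_simps)

interpretation real: hopf_pairing "(*)" "\<lambda>t::real. t"
  by (rule hopf_pairingI) (simp_all add: algebra_simps abs_mult)

interpretation complex: hopf_pairing "(*)" cnj
  by (rule hopf_pairingI) (simp_all add: algebra_simps norm_mult)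

interpretation quaternion: hopf_pairing quat_mult quat_cnj
  by (rule hopf_pairingI) (simp_all add: quat_bilinear norm_quat_mult norm_quat_cnj)

interpretation octonion: hopf_pairing oct_mult oct_cnj
  by (rule hopf_pairingI) (simp_all add: oct_bilinear norm_oct_mult norm_oct_cnj)

theorem proposition1p5:
  fixes a :: real and f :: "real \<Rightarrow> real"
  shows
    "(\<forall>U :: (real \<times> real) set. bounded_smooth_domain U \<and> 0 \<notin> U \<longrightarrow>
        (let \<pi> = hopf (*) (\<lambda>t. t); \<Omega> = \<pi> -` U in
          (\<forall>v. solves_reduced a f U v \<longrightarrow> solves_full a f \<Omega> (v \<circ> \<pi>)) \<and>
          (\<forall>u v. solves_full a f \<Omega> u \<and> unit_invariant_on (*) (closure \<Omega>) u \<and>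
                 (\<forall>z\<in>closure \<Omega>. u z = v (\<pi> z)) \<longrightarrow> solves_reduced a f U v))) \<and>
     (\<forall>U :: (complex \<times> real) set. bounded_smooth_domain U \<and> 0 \<notin> U \<longrightarrow>
        (let \<pi> = hopf (*) cnj; \<Omega> = \<pi> -` U in
          (\<forall>v. solves_reduced a f U v \<longrightarrow> solves_full a f \<Omega> (v \<circ> \<pi>)) \<and>
          (\<forall>u v. solves_full a f \<Omega> u \<and> unit_invariant_on (*) (closure \<Omega>) u \<and>
                 (\<forall>z\<in>closure \<Omega>. u z = v (\<pi> z)) \<longrightarrow> solves_reduced a f U v))) \<and>
     (\<forall>U :: (quaternion \<times> real) set. bounded_smooth_domain U \<and> 0 \<notin> U \<longrightarrow>
        (let \<pi> = hopf quat_mult quat_cnj; \<Omega> = \<pi> -` U in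
          (\<forall>v. solves_reduced a f U v \<longrightarrow> solves_full a f \<Omega> (v \<circ> \<pi>)) \<and>
          (\<forall>u v. solves_full a f \<Omega> u \<and> unit_invariant_on quat_mult (closure \<Omega>) u \<and>
                 (\<forall>z\<in>closure \<Omega>. u z = v (\<pi> z)) \<longrightarrow> solves_reduced a f U v))) \<and>
     (\<forall>U :: (octonion \<times> real) set. bounded_smooth_domain U \<and> 0 \<notin> U \<longrightarrow>
        (let \<pi> = hopf oct_mult oct_cnj; \<Omega> = \<pi> -` U in
          (\<forall>v. solves_reduced a f U v \<longrightarrow> solves_full a f \<Omega> (v \<circ> \<pi>)) \<and>
          (\<forall>u v. solves_full a f \<Omega> u \<and> unit_invariant_on oct_mult (closure \<Omega>) u \<and>
                 (\<forall>z\<in>closure \<Omega>. u z = v (\<pi> z)) \<longrightarrow> solves_reduced a f U v)))"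
  by (intro conjI allI impI; rule real.dirichlet_equivalence complex.dirichlet_equivalence
      quaternion.dirichlet_equivalence octonion.dirichlet_equivalence; assumption)

end
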